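(* Let $s \geq 1$ and $t \geq 2$ be integers and let $\alpha_{s,t}$ be the type-$\alpha$ comb with $s$ teeth of length $t$. Then the number of linear extensions of $\alpha_{s,t}$ that avoid both patterns $213$ and $312$ equals $2^{s-1}$.
   Context: A linear extension of a finite poset $P$ on a set of integers is a listing $v=[v_1,\dots,v_n]$ of all elements of $P$, each exactly once, such that whenever $a \leq_P b$, $a$ appears before $b$. For $w \in S_3$, a sequence $v$ of distinct integers contains $w$ if there are indices $i<j<k$ with $(v_i,v_j,v_k)$ in the same relative order as $(w_1,w_2,w_3)$; otherwise $v$ avoids $w$. The type-$\alpha$ comb $\alpha_{s,t}$ is the poset on $\{1,\dots,st\}$ whose order is generated by the relations $i \leq i+1$ for $1 \leq i \leq s-1$ (the spine $1,\dots,s$) and $x \leq x+s$ for $1 \leq x \leq (t-1)s$ (so the teeth are $c, c+s, \dots, c+(t-1)s$ for $1\le c\le s$). *)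

theory Defs
  imports Main
begin

text \<open>A poset is given by its carrier \<open>A\<close> and its reflexive order relation \<open>r \<subseteq> A \<times> A\<close>.
  As \<open>r\<close> is reflexive, "appears before" is the weak inequality of positions; for distinct
  elements it is strict.\<close>

definition linear_extensions :: "'a set \<Rightarrow> 'a rel \<Rightarrow> 'a list set" where
  "linear_extensions A r =
     {v. distinct v \<and> set v = A \<and>
         (\<forall>i < length v. \<forall>j < length v. (v ! i, v ! j) \<in> r \<longrightarrow> i \<le> j)}"

definition same_relative_order :: "'a::linorder list \<Rightarrow> 'b::linorder list \<Rightarrow> bool" where
  "same_relative_order xs ys \<longleftrightarrow>
     length xs = length ys \<and>
     (\<forall>a < length xs. \<forall>b < length xs. xs ! a < xs ! b \<longleftrightarrow> ys ! a < ys ! b)"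

text \<open>The pattern \<open>w\<close> is a permutation of \<open>{1,2,3}\<close> in one-line notation,
  e.g. \<open>[2,1,3]\<close> for 213.\<close>

definition contains_pattern3 :: "'a::linorder list \<Rightarrow> nat list \<Rightarrow> bool" where
  "contains_pattern3 v w \<longleftrightarrow>
     (\<exists>i j k. i < j \<and> j < k \<and> k < length v \<and> same_relative_order [v ! i, v ! j, v ! k] w)"

definition avoids_pattern3 :: "'a::linorder list \<Rightarrow> nat list \<Rightarrow> bool" where
  "avoids_pattern3 v w \<longleftrightarrow> \<not> contains_pattern3 v w"

definition alpha_comb_carrier :: "nat \<Rightarrow> nat \<Rightarrow> nat set" where
  "alpha_comb_carrier s t = {1..s * t}"

definition alpha_comb_gen :: "nat \<Rightarrow> nat \<Rightarrow> nat rel" where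
  "alpha_comb_gen s t =
     {(i, i + 1) | i. 1 \<le> i \<and> i \<le> s - 1} \<union> {(x, x + s) | x. 1 \<le> x \<and> x \<le> (t - 1) * s}"

text \<open>The restriction only removes the loops that \<^const>\<open>rtrancl\<close> adds outside the carrier.\<close>

definition alpha_comb :: "nat \<Rightarrow> nat \<Rightarrow> nat rel" where
  "alpha_comb s t = Restr ((alpha_comb_gen s t)\<^sup>*) (alpha_comb_carrier s t)"

lemma alpha_comb_gen_subset:
  assumes "t \<ge> 1"
  shows "alpha_comb_gen s t \<subseteq> alpha_comb_carrier s t \<times> alpha_comb_carrier s t"
proof -
  obtain u where t: "t = Suc u"
    using assms by (cases t) auto
  have "s \<le> s * t" "(t - 1) * s + s = s * t"
    by (simp_all add: t algebra_simps)
  then show ?thesis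
    by (auto simp: alpha_comb_gen_def alpha_comb_carrier_def)
qed

lemma alpha_comb_le: "(a, b) \<in> alpha_comb s t \<Longrightarrow> a \<le> b"
proof -
  assume "(a, b) \<in> alpha_comb s t"
  then have "(a, b) \<in> (alpha_comb_gen s t)\<^sup>*"
    by (simp add: alpha_comb_def)
  then show "a \<le> b"
    by (induction rule: rtrancl_induct) (auto simp: alpha_comb_gen_def)
qed

lemma partial_order_on_alpha_comb:
  "partial_order_on (alpha_comb_carrier s t) (alpha_comb s t)"
proof -
  have "refl_on (alpha_comb_carrier s t) (alpha_comb s t)"
    by (auto simp: refl_on_def alpha_comb_def)
  moreover have "alpha_comb s t \<subseteq> alpha_comb_carrier s t \<times> alpha_comb_carrier s t"
    by (auto simp: alpha_comb_def)
  moreover have "trans (alpha_comb s t)"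
    by (auto simp: trans_def alpha_comb_def intro: rtrancl_trans)
  moreover have "antisym (alpha_comb s t)"
    by (auto simp: antisym_def dest!: alpha_comb_le)
  ultimately show ?thesis
    by (simp add: partial_order_on_def preorder_on_def)
qed

end

theory Submission
  imports Defs
begin

text \<open>Avoiding 213 and 312 means having no interior valley, so such a listing increases up to
  the maximum \<open>m\<close> and decreases afterwards; it is determined by the set \<open>D\<close> of the elements after
  \<open>m\<close>. Only elements of \<open>D\<close> come after something larger, and every element of \<open>D\<close> comes after
  everything larger. As the order is contained in \<open>\<le>\<close>, the listing is therefore a linear extension
  iff all elements of \<open>D\<close> are maximal in the poset. So \<open>D\<close> ranges over the sets of maximal elements
  other than \<open>m\<close>, and the comb has \<open>s\<close> maximal elements, the tips of its teeth.\<close>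

text \<open>In both patterns the middle entry is the smallest; they differ only in the order of the
  two ends, and distinctness forces one order or the other.\<close>

lemma avoids_213_312_iff_no_valley:
  assumes "distinct v"
  shows "avoids_pattern3 v [2, 1, 3] \<and> avoids_pattern3 v [3, 1, 2] \<longleftrightarrow>
    (\<forall>i j k. i < j \<longrightarrow> j < k \<longrightarrow> k < length v \<longrightarrow> \<not> (v ! j < v ! i \<and> v ! j < v ! k))"
proof -
  have pat: "same_relative_order [a, b, c] [2, 1, 3::nat] \<or> same_relative_order [a, b, c] [3, 1, 2::nat]
      \<longleftrightarrow> b < a \<and> b < c" if "a \<noteq> c" for a b c :: 'a
    using that by (auto simp: same_relative_order_def All_less_Suc numeral_3_eq_3)
  have ends: "v ! i \<noteq> v ! k" if "i < j" "j < k" "k < length v" for i j k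
    using assms that by (simp add: nth_eq_iff_index_eq)
  have "contains_pattern3 v [2, 1, 3] \<or> contains_pattern3 v [3, 1, 2] \<longleftrightarrow>
      (\<exists>i j k. i < j \<and> j < k \<and> k < length v \<and>
        (same_relative_order [v ! i, v ! j, v ! k] [2, 1, 3::nat] \<or>
         same_relative_order [v ! i, v ! j, v ! k] [3, 1, 2::nat]))"
    unfolding contains_pattern3_def by blast
  also have "\<dots> \<longleftrightarrow>
      (\<exists>i j k. i < j \<and> j < k \<and> k < length v \<and> v ! j < v ! i \<and> v ! j < v ! k)"
    by (intro ex_cong1 conj_cong refl pat ends)
  finally show ?thesis
    unfolding avoids_pattern3_def by blast
qed

definition maximal_elements :: "'a set \<Rightarrow> 'a rel \<Rightarrow> 'a set" where
  "maximal_elements A r = {x \<in> A. \<forall>y \<in> A. (x, y) \<in> r \<longrightarrow> y = x}"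

definition unimodal_list :: "'a::linorder set \<Rightarrow> 'a set \<Rightarrow> 'a list" where
  "unimodal_list A D =
     sorted_list_of_set (A - {Max A} - D) @ Max A # rev (sorted_list_of_set D)"

context
  fixes A D :: "'a::linorder set"
  assumes fin: "finite A" and ne: "A \<noteq> {}" and D: "D \<subseteq> A - {Max A}"
begin

lemma set_unimodal_list: "set (unimodal_list A D) = A"
  using fin ne D finite_subset[OF D] by (auto simp: unimodal_list_def intro: Max_in)

lemma distinct_unimodal_list: "distinct (unimodal_list A D)"
  using fin D finite_subset[OF D] by (auto simp: unimodal_list_def)

text \<open>A position lies on the ascent or on the descent. This serves twice: an entry preceded by
  a larger one must be in \<open>D\<close>, and a valley fits neither case.\<close>

lemma unimodal_list_nth_cases:
  assumes "j < length (unimodal_list A D)"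
  shows "(\<forall>i < j. unimodal_list A D ! i < unimodal_list A D ! j) \<or>
    unimodal_list A D ! j \<in> D \<and>
    (\<forall>k. j < k \<longrightarrow> k < length (unimodal_list A D) \<longrightarrow> unimodal_list A D ! k < unimodal_list A D ! j)"
proof -
  define xs where "xs = sorted_list_of_set (A - {Max A} - D)"
  define ys where "ys = rev (sorted_list_of_set D)"
  have v: "unimodal_list A D = (xs @ [Max A]) @ ys"
    by (simp add: unimodal_list_def xs_def ys_def)
  have "finite D" using D fin finite_subset by blast
  have "\<And>x. x \<in> A - {Max A} \<Longrightarrow> x < Max A"
    using fin by (simp add: order_less_le)
  then have xs: "sorted_wrt (<) (xs @ [Max A])"
    using fin by (auto simp: xs_def sorted_wrt_append)
  have ys: "sorted_wrt (>) ys" "set ys = D"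
    using \<open>finite D\<close> by (simp_all add: ys_def sorted_wrt_rev)
  show ?thesis
  \<comment> \<open>The maximum itself is counted with the ascent.\<close>
  proof (cases "j < length (xs @ [Max A])")
    case True
    have "unimodal_list A D ! i < unimodal_list A D ! j" if "i < j" for i
      using sorted_wrt_nth_less[OF xs that True] that True
      by (simp only: v nth_append if_True less_trans)
    then show ?thesis by blast
  next
    case False
    define l where "l = length (xs @ [Max A])"
    have nth: "unimodal_list A D ! k = ys ! (k - l)" if "l \<le> k" for k
      using that unfolding v l_def by (subst nth_append) simp
    have len: "length (unimodal_list A D) = l + length ys"
      by (simp add: v l_def)
    have j: "l \<le> j" using False by (simp add: l_def)
    have "ys ! (k - l) < ys ! (j - l)" if "j < k" "k < length (unimodal_list A D)" for k
      using that j len by (intro sorted_wrt_nth_less[OF ys(1)]) auto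
    moreover have "ys ! (j - l) \<in> set ys"
      using assms j len by (intro nth_mem) auto
    ultimately show ?thesis
      using j by (auto simp: nth ys(2))
  qed
qed

end

text \<open>The map \<open>unimodal_list A\<close> is a bijection from the subsets of
  \<open>?M - {?m}\<close> onto the listings counted. A particular poset then enters only through
  its number of maximal elements.\<close>

lemma card_avoiding_linear_extensions:
  fixes A :: "'a::linorder set"
  assumes fin: "finite A" and ne: "A \<noteq> {}" and le: "\<And>a b. (a, b) \<in> r \<Longrightarrow> a \<le> b"
  shows "card {v \<in> linear_extensions A r. avoids_pattern3 v [2, 1, 3] \<and> avoids_pattern3 v [3, 1, 2]}
    = 2 ^ (card (maximal_elements A r) - 1)"
proof -
  let ?m = "Max A" and ?M = "maximal_elements A r"
  let ?S = "{v \<in> linear_extensions A r.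
    avoids_pattern3 v [2, 1, 3] \<and> avoids_pattern3 v [3, 1, 2]}"
  have M_sub: "?M \<subseteq> A" by (auto simp: maximal_elements_def)
  \<comment> \<open>This accounts for the \<open>- 1\<close> in the exponent: \<open>?m\<close> is
    always maximal but never in \<open>D\<close>.\<close>
  have "?m \<in> ?M"
    using fin ne le by (auto simp: maximal_elements_def intro: antisym)
  have "inj_on (unimodal_list A) (Pow (?M - {?m}))"
  proof (rule inj_onI)
    fix D E assume DE: "D \<in> Pow (?M - {?m})" "E \<in> Pow (?M - {?m})"
      and eq: "unimodal_list A D = unimodal_list A E"
    have "finite D" "finite E"
      using DE M_sub fin by (meson PowD finite_Diff finite_subset)+
    \<comment> \<open>The maximum occurs only once, so equal lists split there into equal
      halves.\<close>
    then have "sorted_list_of_set D = sorted_list_of_set E"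
      using eq fin DE unfolding unimodal_list_def by (subst (asm) append_Cons_eq_iff) auto
    then show "D = E"
      using \<open>finite D\<close> \<open>finite E\<close> by (metis set_sorted_list_of_set)
  qed
  moreover have "unimodal_list A ` Pow (?M - {?m}) = ?S"
  proof (intro equalityI subsetI)
    fix v assume "v \<in> unimodal_list A ` Pow (?M - {?m})"
    then obtain D where D: "D \<subseteq> ?M - {?m}" and v: "v = unimodal_list A D" by auto
    have D': "D \<subseteq> A - {?m}" using D M_sub by auto
    note cases = unimodal_list_nth_cases[OF fin ne D', folded v]
    have dist: "distinct v" and set: "set v = A"
      using set_unimodal_list[OF fin ne D'] distinct_unimodal_list[OF fin ne D'] v by auto
    have "i \<le> j" if "i < length v" "j < length v" "(v ! i, v ! j) \<in> r" for i j
    proof (rule ccontr)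
      assume "\<not> i \<le> j"
      \<comment> \<open>Here \<open>v ! j\<close> stands before \<open>v ! i\<close> without being
        smaller, which rules out the ascent for \<open>v ! i\<close>.\<close>
      then have "v ! i \<in> D"
        using cases[OF that(1)] le[OF that(3)] by (auto simp: not_less[symmetric])
      then have "v ! i \<in> ?M" using D by blast
      then have "v ! j = v ! i"
        using that set nth_mem[OF that(2)] by (simp add: maximal_elements_def)
      then show False
        using dist that \<open>\<not> i \<le> j\<close> by (simp add: nth_eq_iff_index_eq)
    qed
    \<comment> \<open>The entry at \<open>i\<close> rules out the ascent for \<open>j\<close>, the
      entry at \<open>k\<close> the descent.\<close>
    moreover have "\<not> (v ! j < v ! i \<and> v ! j < v ! k)" if "i < j" "j < k" "k < length v" for i j k
      using cases[of j] that by (meson less_trans less_asym)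
    ultimately show "v \<in> ?S"
      using dist set by (simp add: linear_extensions_def avoids_213_312_iff_no_valley del: One_nat_def)
  next
    fix v assume S: "v \<in> ?S"
    then have dist: "distinct v" and set: "set v = A"
      and ext: "\<And>i j. i < length v \<Longrightarrow> j < length v \<Longrightarrow> (v ! i, v ! j) \<in> r \<Longrightarrow> i \<le> j"
      by (auto simp: linear_extensions_def)
    have valley: "\<not> (v ! j < v ! i \<and> v ! j < v ! k)" if "i < j" "j < k" "k < length v" for i j k
      using S that avoids_213_312_iff_no_valley[OF dist] by blast
    obtain xs ys where v: "v = xs @ ?m # ys"
      using split_list[of ?m v] set fin ne by auto
    let ?l = "length xs"
    have v_l: "v ! ?l = ?m" and l: "?l < length v" by (simp_all add: v)
    have less_m: "v ! i < ?m" if "i < length v" "i \<noteq> ?l" for i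
    proof -
      have "v ! i \<noteq> v ! ?l" using dist that l by (simp add: nth_eq_iff_index_eq)
      then show ?thesis using v_l fin set that(1) by (metis Max_ge nth_mem order_less_le)
    qed
    have nth_ys: "v ! (Suc ?l + i) = ys ! i" for i
      by (simp add: v nth_append)
    \<comment> \<open>A drop inside \<open>xs\<close> would form a valley with the maximum on its
      right.\<close>
    have "xs ! i \<le> xs ! j" if "i < j" "j < ?l" for i j
      using valley[of i j ?l] less_m[of j] that v_l by (auto simp: v nth_append not_less[symmetric])
    then have sx: "sorted xs" by (simp add: sorted_iff_nth_mono_less)
    \<comment> \<open>Symmetrically, a rise inside \<open>ys\<close> would form a valley with the
      maximum on its left.\<close>
    have "ys ! j \<le> ys ! i" if "i < j" "j < length ys" for i j
      using valley[of ?l "Suc ?l + i" "Suc ?l + j"] less_m[of "Suc ?l + i"] that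
      unfolding v_l nth_ys by (auto simp: v not_less[symmetric])
    then have sy: "sorted (rev ys)"
      unfolding sorted_wrt_rev by (simp add: sorted_wrt_iff_nth_less)
    have "set xs = A - {?m} - set ys" using dist set by (auto simp: v)
    then have "unimodal_list A (set ys) = v"
      using sx sy dist sorted_list_of_set.idem_if_sorted_distinct[of xs]
        sorted_list_of_set.idem_if_sorted_distinct[of "rev ys"]
      by (simp add: unimodal_list_def v)
    moreover have "set ys \<subseteq> ?M - {?m}"
    proof
      fix y assume "y \<in> set ys"
      then obtain a where a: "a < length ys" "y = ys ! a" by (auto simp: in_set_conv_nth)
      then have y: "Suc ?l + a < length v" "y = v ! (Suc ?l + a)"
        using nth_ys by (auto simp: v)
      \<comment> \<open>Any other \<open>z\<close> above \<open>y\<close> in the order is a larger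
        element and must come after \<open>y\<close>, so \<open>?m\<close>, \<open>y\<close>,
        \<open>z\<close> would be a valley.\<close>
      have "z = y" if "z \<in> A" "(y, z) \<in> r" for z
      proof (rule ccontr)
        assume "z \<noteq> y"
        then have "y < z" using le[OF that(2)] by simp
        obtain k where k: "k < length v" "z = v ! k"
          using \<open>z \<in> A\<close> set by (auto simp: in_set_conv_nth)
        have "Suc ?l + a < k"
          using ext[OF y(1) k(1)] that y k \<open>z \<noteq> y\<close> by (metis order_less_le)
        then show False
          using valley[of ?l "Suc ?l + a" k] less_m[OF y(1)] k y \<open>y < z\<close> v_l by simp
      qed
      then show "y \<in> ?M - {?m}"
        using less_m[OF y(1)] y set by (auto simp: maximal_elements_def)
    qed
    ultimately show "v \<in> unimodal_list A ` Pow (?M - {?m})" by (metis PowI imageI)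
  qed
  ultimately have "card ?S = card (Pow (?M - {?m}))" by (metis card_image)
  then show ?thesis
    using \<open>?m \<in> ?M\<close> fin M_sub by (simp add: card_Pow finite_subset)
qed

text \<open>Below the last row, \<open>x + s\<close> lies above \<open>x\<close>. In the last row no
  generating relation starts: the tooth relations end there, and the spine lies lower because
  \<open>t \<ge> 2\<close> gives \<open>s \<le> (t - 1) * s\<close>.\<close>

lemma maximal_elements_alpha_comb:
  assumes "t \<ge> 2"
  shows "maximal_elements (alpha_comb_carrier s t) (alpha_comb s t) = {(t - 1) * s <.. s * t}"
proof -
  have st: "s * t = (t - 1) * s + s" "s \<le> (t - 1) * s"
    using assms by (cases t; auto simp: algebra_simps)+
  have "x \<notin> maximal_elements (alpha_comb_carrier s t) (alpha_comb s t)"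
    if "1 \<le> x" "x \<le> (t - 1) * s" for x
  proof -
    have "(x, x + s) \<in> alpha_comb s t"
      using that st by (auto simp: alpha_comb_def alpha_comb_carrier_def alpha_comb_gen_def)
    \<comment> \<open>Needed for \<open>x + s\<close> to differ from \<open>x\<close>.\<close>
    moreover have "s \<noteq> 0" using that by (intro notI) simp
    ultimately show ?thesis
      by (auto simp: maximal_elements_def alpha_comb_def)
  qed
  moreover have "y = x" if "(t - 1) * s < x" "(x, y) \<in> alpha_comb s t" for x y
  proof -
    have "(x, z) \<notin> alpha_comb_gen s t" for z
      using le_less_trans[OF st(2) that(1)] that(1) by (auto simp: alpha_comb_gen_def)
    moreover have "(x, y) \<in> (alpha_comb_gen s t)\<^sup>*" using that by (simp add: alpha_comb_def)
    \<comment> \<open>A chain from \<open>x\<close> has no possible first step, so it is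
      trivial.\<close>
    ultimately show ?thesis by (metis converse_rtranclE)
  qed
  ultimately show ?thesis
    by (force simp: maximal_elements_def alpha_comb_carrier_def)
qed

theorem theorem12:
  fixes s t :: nat
  assumes "s \<ge> 1" and "t \<ge> 2"
  shows "card {v \<in> linear_extensions (alpha_comb_carrier s t) (alpha_comb s t).
                 avoids_pattern3 v [2, 1, 3] \<and> avoids_pattern3 v [3, 1, 2]} = 2 ^ (s - 1)"
proof -
  \<comment> \<open>The tips carry the last \<open>s\<close> labels.\<close>
  have "card (maximal_elements (alpha_comb_carrier s t) (alpha_comb s t)) = s"
    using assms by (cases t) (auto simp: maximal_elements_alpha_comb algebra_simps)
  moreover have "finite (alpha_comb_carrier s t)" "alpha_comb_carrier s t \<noteq> {}"
    using assms by (auto simp: alpha_comb_carrier_def)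
  ultimately show ?thesis
    using alpha_comb_le by (subst card_avoiding_linear_extensions) auto
qed

end
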